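(* Let $\Omega$ be a topological space and $X$ a Hausdorff locally convex topological vector space over $\mathbb{C}$. Let $A \subset C(\Omega, \mathbb{C})$, $f \in F(\Omega, X)$, $v \in F(\Omega, \mathbb{R}_+)$. Suppose that $\overline{(vf)(\Omega)}$ is compact and $vf$ is continuous on $\mathrm{supp}\, v$ (respectively, $\overline{f(\mathrm{supp}\, v)}$ is compact and $f$ is continuous on $\mathrm{supp}\, v$). If $A$ $\beta$-separates disjoint Lebesgue sets of $vf$ (respectively, of $f$) in $\mathrm{supp}\, v$, then for any $(A, v)$-antisymmetric $z$-filter $\mathcal{F}$ on $\Omega$, the set $\bigcap_{F \in \mathcal{F}} \overline{(vf)(F \cap \mathrm{supp}\, v)}$ (respectively, $\bigcap_{F \in \mathcal{F}} \overline{f(F \cap \mathrm{supp}\, v)}$) consists of a single point.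
   Context: Topological spaces are not assumed Hausdorff. $vf(x)=v(x)f(x)$; $\mathrm{supp}\,v$ is the closure of $\{v\neq0\}$. $X^*$ is the space of continuous linear functionals $X\to\mathbb{C}$, $\Re$ the real part. A zero-set is $h^{-1}(0)$ with $h\in C(\Omega,\mathbb{R})$; a $z$-filter is a nonempty family $\mathcal{F}$ of zero-sets with $\emptyset\notin\mathcal{F}$, closed under finite intersections and under passing to larger zero-sets. $\mathcal{F}$ is $(A,v)$-antisymmetric if every $F\in\mathcal{F}$ meets $\mathrm{supp}\,v$ and, for each $\phi\in A$ with $\bigcap_{F\in\mathcal{F}}\overline{\phi(F\cap\mathrm{supp}\,v)}\subset[0,1]$ (closures in $\mathbb{C}\cup\{\infty\}$), this intersection is a single point. For $h\in F(\Omega,X)$, $A$ "$\beta$-separates disjoint Lebesgue sets of $h$ in $\mathrm{supp}\,v$" means: for any $(A,v)$-antisymmetric $z$-filter $\mathcal{F}$, any $e^*\in X^*$ and $a<b$ real, there is $F\in\mathcal{F}$ with $F\cap L_a=\emptyset$ or $F\cap L^b=\emptyset$, where $L_a=\{x\in\mathrm{supp}\,v:\Re e^*(h(x))\le a\}$, $L^b=\{x\in\mathrm{supp}\,v:\Re e^*(h(x))\ge b\}$. *)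

theory Defs
  imports "HOL-Analysis.Analysis"
begin

text \<open>The space X: a type 'x carrying a (Hausdorff, by the class t2_space) topology and
an additive group structure, together with a complex scalar multiplication smul.\<close>

definition complex_vs :: "(complex \<Rightarrow> 'x::ab_group_add \<Rightarrow> 'x) \<Rightarrow> bool" where
  "complex_vs smul \<longleftrightarrow>
     (\<forall>a x y. smul a (x + y) = smul a x + smul a y) \<and>
     (\<forall>a b x. smul (a + b) x = smul a x + smul b x) \<and>
     (\<forall>a b x. smul a (smul b x) = smul (a * b) x) \<and>
     (\<forall>x. smul 1 x = x)"

definition convex_wrt :: "(complex \<Rightarrow> 'x::ab_group_add \<Rightarrow> 'x) \<Rightarrow> 'x set \<Rightarrow> bool" where
  "convex_wrt smul C \<longleftrightarrow>
     (\<forall>x\<in>C. \<forall>y\<in>C. \<forall>t::real. 0 \<le> t \<and> t \<le> 1 \<longrightarrow>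
        smul (complex_of_real t) x + smul (complex_of_real (1 - t)) y \<in> C)"

text \<open>Hausdorff locally convex topological vector space over the complex numbers.\<close>
definition hausdorff_lctvs :: "(complex \<Rightarrow> 'x::{t2_space,ab_group_add} \<Rightarrow> 'x) \<Rightarrow> bool" where
  "hausdorff_lctvs smul \<longleftrightarrow>
     complex_vs smul \<and>
     continuous_on UNIV (\<lambda>p::'x \<times> 'x. fst p + snd p) \<and>
     continuous_on UNIV (\<lambda>p::complex \<times> 'x. smul (fst p) (snd p)) \<and>
     (\<forall>U. open U \<and> (0::'x) \<in> U \<longrightarrow>
        (\<exists>C. open C \<and> 0 \<in> C \<and> C \<subseteq> U \<and> convex_wrt smul C))"

text \<open>X^*: continuous linear functionals X \<rightarrow> C.\<close>
definition dual_space :: "(complex \<Rightarrow> 'x::{topological_space,ab_group_add} \<Rightarrow> 'x) \<Rightarrow> ('x \<Rightarrow> complex) set" where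
  "dual_space smul = {e. (\<forall>x y. e (x + y) = e x + e y) \<and> (\<forall>c x. e (smul c x) = c * e x)
                          \<and> continuous_on UNIV e}"

text \<open>supp v = closure of {v \<noteq> 0} in \<Omega>.\<close>
definition supp :: "'a topology \<Rightarrow> ('a \<Rightarrow> real) \<Rightarrow> 'a set" where
  "supp T v = T closure_of {x \<in> topspace T. v x \<noteq> 0}"

text \<open>The extended complex plane C \<union> {\<infinity>} (one-point compactification); None is \<infinity>.\<close>
definition ext_plane :: "complex option topology" where
  "ext_plane = topology (\<lambda>U. if None \<in> U then compact (- (Some -` U)) else open (Some -` U))"

definition zero_set :: "'a topology \<Rightarrow> 'a set \<Rightarrow> bool" where
  "zero_set T Z \<longleftrightarrow> (\<exists>h. continuous_map T euclideanreal h \<and> Z = {x \<in> topspace T. h x = 0})"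

definition z_filter :: "'a topology \<Rightarrow> 'a set set \<Rightarrow> bool" where
  "z_filter T \<F> \<longleftrightarrow> \<F> \<noteq> {} \<and> (\<forall>F\<in>\<F>. zero_set T F) \<and> {} \<notin> \<F> \<and>
     (\<forall>F\<in>\<F>. \<forall>G\<in>\<F>. F \<inter> G \<in> \<F>) \<and>
     (\<forall>F\<in>\<F>. \<forall>Z. zero_set T Z \<and> F \<subseteq> Z \<longrightarrow> Z \<in> \<F>)"

definition antisymmetric_zf :: "'a topology \<Rightarrow> ('a \<Rightarrow> complex) set \<Rightarrow> ('a \<Rightarrow> real) \<Rightarrow> 'a set set \<Rightarrow> bool" where
  "antisymmetric_zf T A v \<F> \<longleftrightarrow> z_filter T \<F> \<and>
     (\<forall>F\<in>\<F>. F \<inter> supp T v \<noteq> {}) \<and>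
     (\<forall>\<phi>\<in>A. (\<Inter>F\<in>\<F>. ext_plane closure_of (Some ` \<phi> ` (F \<inter> supp T v)))
                 \<subseteq> Some ` complex_of_real ` {0..1}
             \<longrightarrow> (\<exists>p. (\<Inter>F\<in>\<F>. ext_plane closure_of (Some ` \<phi> ` (F \<inter> supp T v))) = {p}))"

definition beta_separates ::
  "'a topology \<Rightarrow> ('a \<Rightarrow> complex) set \<Rightarrow> ('a \<Rightarrow> real) \<Rightarrow>
   (complex \<Rightarrow> 'x::{topological_space,ab_group_add} \<Rightarrow> 'x) \<Rightarrow> ('a \<Rightarrow> 'x) \<Rightarrow> bool" where
  "beta_separates T A v smul h \<longleftrightarrow>
     (\<forall>\<F> e a b. antisymmetric_zf T A v \<F> \<and> e \<in> dual_space smul \<and> a < b \<longrightarrow>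
        (\<exists>F\<in>\<F>. F \<inter> {x \<in> supp T v. Re (e (h x)) \<le> a} = {}
               \<or> F \<inter> {x \<in> supp T v. Re (e (h x)) \<ge> b} = {}))"

end

theory Submission
  imports Defs
begin

text \<open>
  The closures of \<open>h (F \<inter> supp v)\<close>, \<open>F \<in> \<F>\<close>, lie in one compact set and have the
  finite intersection property, since \<open>\<F>\<close> is closed under finite intersections and each of
  its members meets \<open>supp v\<close>; so their intersection is nonempty. Two distinct points \<open>p, q\<close>
  of it are separated by some \<open>e \<in> X*\<close>; applying \<open>\<beta>\<close>-separation to levels
  \<open>a < b\<close> strictly between \<open>Re e(p)\<close> and \<open>Re e(q)\<close> gives an \<open>F \<in> \<F>\<close> for which
  \<open>h (F \<inter> supp v)\<close> lies in a closed half-space missing \<open>p\<close> or \<open>q\<close>.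

  Point separation by \<open>X*\<close> comes from Hahn--Banach: the Minkowski functional of a convex open
  neighbourhood of \<open>0\<close> avoiding \<open>q - p\<close> dominates a real-linear \<open>l\<close> with
  \<open>l (q - p) \<ge> 1\<close>; being bounded near \<open>0\<close>, \<open>l\<close> is continuous, and
  \<open>x \<mapsto> l x - i l (i x)\<close> belongs to \<open>X*\<close>. For Hahn--Banach itself take, by Zorn, a
  minimal sublinear functional \<open>m\<close> below the given one: minimality makes \<open>m\<close> equal to each of
  its directional reducts \<open>x \<mapsto> inf {m (x + t y) - t m y | t \<ge> 0}\<close>, so \<open>m\<close> is
  superadditive, hence linear.
\<close>

locale real_vector_space = vector_space scale
  for scale :: "real \<Rightarrow> 'b::ab_group_add \<Rightarrow> 'b" (infixr \<open>*\<^sub>s\<close> 75)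
begin

lemma linear_functional_iff:
  "Vector_Spaces.linear (*\<^sub>s) (*) l \<longleftrightarrow>
     (\<forall>x y. l (x + y) = l x + l y) \<and> (\<forall>r x. l (r *\<^sub>s x) = r * l x)"
  unfolding Vector_Spaces.linear_iff
  by (auto intro: vector_space_axioms simp: vector_space_def algebra_simps)

definition sublinear :: "('b \<Rightarrow> real) \<Rightarrow> bool" where
  "sublinear q \<longleftrightarrow> (\<forall>x y. q (x + y) \<le> q x + q y) \<and> (\<forall>r>0. \<forall>x. q (r *\<^sub>s x) = r * q x)"

lemma sublinearI:
  assumes "\<And>x y. q (x + y) \<le> q x + q y" and "\<And>r x. r > 0 \<Longrightarrow> q (r *\<^sub>s x) \<le> r * q x"
  shows "sublinear q"
proof -
  have "q (r *\<^sub>s x) = r * q x" if "r > 0" for r x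
  proof -
    have "q x = q ((1/r) *\<^sub>s r *\<^sub>s x)" using that by simp
    also have "\<dots> \<le> (1/r) * q (r *\<^sub>s x)" using assms(2)[of "1/r" "r *\<^sub>s x"] that by simp
    finally show ?thesis using assms(2)[OF that, of x] that by (simp add: field_simps)
  qed
  with assms(1) show ?thesis unfolding sublinear_def by blast
qed

lemma sublinear_add_le: "sublinear q \<Longrightarrow> q (x + y) \<le> q x + q y"
  unfolding sublinear_def by blast

lemma sublinear_zero: "sublinear q \<Longrightarrow> q 0 = 0"
proof -
  assume "sublinear q"
  then have "\<forall>x. q (2 *\<^sub>s x) = 2 * q x" unfolding sublinear_def by simp
  then have "q (2 *\<^sub>s 0) = 2 * q 0" by blast
  then show "q 0 = 0" by simp
qed

lemma sublinear_scale_nonneg: "sublinear q \<Longrightarrow> t \<ge> 0 \<Longrightarrow> q (t *\<^sub>s x) = t * q x"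
  by (cases "t = 0") (auto simp: sublinear_zero sublinear_def)

lemma sublinear_neg_le: "sublinear q \<Longrightarrow> - q (- x) \<le> q x"
  using sublinear_add_le[of q x "- x"] sublinear_zero[of q] by simp

definition directional_reduct :: "('b \<Rightarrow> real) \<Rightarrow> 'b \<Rightarrow> 'b \<Rightarrow> real" where
  "directional_reduct q y x = (INF t\<in>{0..}. q (x + t *\<^sub>s y) - t * q y)"

lemma directional_reduct_le_shift:
  assumes q: "sublinear q" and t: "t \<ge> 0"
  shows "directional_reduct q y x \<le> q (x + t *\<^sub>s y) - t * q y"
proof -
  have "- q (- x) \<le> q (x + s *\<^sub>s y) - s * q y" if "s \<ge> 0" for s
    using sublinear_add_le[OF q, of "x + s *\<^sub>s y" "- x"] sublinear_scale_nonneg[OF q that, of y]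
    by (simp add: add.commute)
  then have "bdd_below ((\<lambda>s. q (x + s *\<^sub>s y) - s * q y) ` {0..})"
    by (intro bdd_belowI2) simp
  with t show ?thesis
    unfolding directional_reduct_def by (intro cINF_lower) auto
qed

lemma directional_reduct_le: "sublinear q \<Longrightarrow> directional_reduct q y x \<le> q x"
  using directional_reduct_le_shift[of q 0] by simp

lemma directional_reduct_greatest:
  "(\<And>t. t \<ge> 0 \<Longrightarrow> c \<le> q (x + t *\<^sub>s y) - t * q y) \<Longrightarrow> c \<le> directional_reduct q y x"
  unfolding directional_reduct_def by (rule cINF_greatest) auto

lemma sublinear_directional_reduct:
  assumes q: "sublinear q"
  shows "sublinear (directional_reduct q y)"
proof (rule sublinearI)
  fix x1 x2
  have "directional_reduct q y (x1 + x2) - (q (x2 + t2 *\<^sub>s y) - t2 * q y) \<le> directional_reduct q y x1"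
    if t2: "t2 \<ge> 0" for t2
  proof (rule directional_reduct_greatest)
    fix t1 :: real
    assume t1: "t1 \<ge> 0"
    have "directional_reduct q y (x1 + x2) \<le> q (x1 + x2 + (t1 + t2) *\<^sub>s y) - (t1 + t2) * q y"
      using directional_reduct_le_shift[OF q] t1 t2 by simp
    also have "x1 + x2 + (t1 + t2) *\<^sub>s y = (x1 + t1 *\<^sub>s y) + (x2 + t2 *\<^sub>s y)"
      by (simp add: algebra_simps)
    also have "q \<dots> \<le> q (x1 + t1 *\<^sub>s y) + q (x2 + t2 *\<^sub>s y)"
      by (rule sublinear_add_le[OF q])
    finally show "directional_reduct q y (x1 + x2) - (q (x2 + t2 *\<^sub>s y) - t2 * q y)
        \<le> q (x1 + t1 *\<^sub>s y) - t1 * q y"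
      by (simp add: algebra_simps)
  qed
  then have "directional_reduct q y (x1 + x2) - directional_reduct q y x1 \<le> directional_reduct q y x2"
    by (intro directional_reduct_greatest) (simp add: algebra_simps)
  then show "directional_reduct q y (x1 + x2) \<le> directional_reduct q y x1 + directional_reduct q y x2"
    by simp
next
  fix r :: real and x
  assume r: "r > 0"
  have "directional_reduct q y (r *\<^sub>s x) / r \<le> directional_reduct q y x"
  proof (rule directional_reduct_greatest)
    fix t :: real
    assume t: "t \<ge> 0"
    have "directional_reduct q y (r *\<^sub>s x) \<le> q (r *\<^sub>s x + (r * t) *\<^sub>s y) - (r * t) * q y"
      using directional_reduct_le_shift[OF q] t r by simp
    also have "r *\<^sub>s x + (r * t) *\<^sub>s y = r *\<^sub>s (x + t *\<^sub>s y)"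
      by (simp add: scale_right_distrib)
    also have "q \<dots> = r * q (x + t *\<^sub>s y)"
      using sublinear_scale_nonneg[OF q] r by simp
    finally show "directional_reduct q y (r *\<^sub>s x) / r \<le> q (x + t *\<^sub>s y) - t * q y"
      using r by (simp add: field_simps)
  qed
  then show "directional_reduct q y (r *\<^sub>s x) \<le> r * directional_reduct q y x"
    using r by (simp add: field_simps)
qed

lemma sublinear_Inf_chain:
  assumes ne: "C \<noteq> {}" and C: "\<And>q. q \<in> C \<Longrightarrow> sublinear q \<and> q \<le> P"
    and chain: "\<And>a b. a \<in> C \<Longrightarrow> b \<in> C \<Longrightarrow> a \<le> b \<or> b \<le> a"
  shows "sublinear (Inf C)" and "\<And>q. q \<in> C \<Longrightarrow> Inf C \<le> q"
proof -
  have "- P (- x) \<le> q x" if "q \<in> C" for q x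
  proof -
    from C[OF that] have "sublinear q" "q (- x) \<le> P (- x)" by (auto simp: le_fun_def)
    with sublinear_neg_le[of q x] show ?thesis by linarith
  qed
  then have bdd: "bdd_below ((\<lambda>q. q x) ` C)" for x
    by (intro bdd_belowI2)
  show lower: "Inf C \<le> q" if "q \<in> C" for q
    using that bdd by (auto simp: le_fun_def intro: cINF_lower)
  have greatest: "c \<le> Inf C x" if "\<And>q. q \<in> C \<Longrightarrow> c \<le> q x" for c x
    using that ne by (auto intro: cINF_greatest)
  show "sublinear (Inf C)"
  proof (rule sublinearI)
    fix x y
    have "Inf C (x + y) \<le> q1 x + q2 y" if q1: "q1 \<in> C" and q2: "q2 \<in> C" for q1 q2
    proof -
      obtain q where q: "q \<in> C" "q \<le> q1" "q \<le> q2"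
        using chain[OF q1 q2] q1 q2 by auto
      have "Inf C (x + y) \<le> q (x + y)" using lower[OF q(1)] by (simp add: le_fun_def)
      also have "\<dots> \<le> q x + q y" using C[OF q(1)] sublinear_add_le by blast
      also have "\<dots> \<le> q1 x + q2 y" using q(2,3) by (simp add: le_fun_def add_mono)
      finally show ?thesis .
    qed
    then have "Inf C (x + y) - q2 y \<le> Inf C x" if "q2 \<in> C" for q2
      using that by (intro greatest) (simp add: algebra_simps)
    then have "Inf C (x + y) - Inf C x \<le> Inf C y"
      by (intro greatest) (simp add: algebra_simps)
    then show "Inf C (x + y) \<le> Inf C x + Inf C y" by simp
  next
    fix r :: real and x
    assume r: "r > 0"
    have "Inf C (r *\<^sub>s x) / r \<le> Inf C x"
    proof (rule greatest)
      fix q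
      assume q: "q \<in> C"
      have "Inf C (r *\<^sub>s x) \<le> q (r *\<^sub>s x)" using lower[OF q] by (simp add: le_fun_def)
      also have "\<dots> = r * q x" using C[OF q] r sublinear_scale_nonneg by simp
      finally show "Inf C (r *\<^sub>s x) / r \<le> q x" using r by (simp add: field_simps)
    qed
    then show "Inf C (r *\<^sub>s x) \<le> r * Inf C x" using r by (simp add: field_simps)
  qed
qed

lemma exists_minimal_sublinear_below:
  assumes P: "sublinear P"
  obtains m where "sublinear m" "m \<le> P" "\<And>q. sublinear q \<Longrightarrow> q \<le> m \<Longrightarrow> q = m"
proof -
  define S where "S = {q. sublinear q \<and> q \<le> P}"
  have "partial_order_on S (relation_of (\<ge>) S)"
    by (rule partial_order_on_relation_ofI) auto
  moreover have "\<exists>u\<in>S. \<forall>q\<in>C. u \<le> q" if C: "C \<in> Chains (relation_of (\<ge>) S)" for C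
  proof (cases "C = {}")
    case True
    then show ?thesis using P unfolding S_def by auto
  next
    case False
    have CS: "sublinear q \<and> q \<le> P" if "q \<in> C" for q
      using Chains_relation_of[OF C] that unfolding S_def by blast
    have "a \<le> b \<or> b \<le> a" if "a \<in> C" "b \<in> C" for a b
      using C that unfolding Chains_def relation_of_def by auto
    note Inf_C = sublinear_Inf_chain[OF False CS this]
    have "Inf C \<le> P"
      using False Inf_C(2) CS by (auto intro: order.trans)
    with Inf_C show ?thesis unfolding S_def by blast
  qed
  ultimately obtain m where "m \<in> S" "\<And>q. q \<in> S \<Longrightarrow> q \<le> m \<Longrightarrow> q = m"
    using predicate_Zorn[of S "(\<ge>)"] by blast
  then show ?thesis
    using that unfolding S_def by (auto intro: order.trans)
qed

lemma minimal_sublinear_linear: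
  assumes m: "sublinear m" and minimal: "\<And>q. sublinear q \<Longrightarrow> q \<le> m \<Longrightarrow> q = m"
  shows "Vector_Spaces.linear (*\<^sub>s) (*) m"
proof -
  have reduct: "directional_reduct m y = m" for y
    using minimal sublinear_directional_reduct[OF m] directional_reduct_le[OF m]
    by (simp add: le_fun_def)
  have add: "m (x + y) = m x + m y" for x y
    using directional_reduct_le_shift[OF m, of 1 y x] reduct[of y] sublinear_add_le[OF m, of x y]
    by simp
  have neg: "m (- x) = - m x" for x
    using add[of x "- x"] sublinear_zero[OF m] by simp
  have "m (r *\<^sub>s x) = r * m x" for r x
  proof (cases "r \<ge> 0")
    case True
    then show ?thesis using sublinear_scale_nonneg[OF m] by blast
  next
    case False
    then show ?thesis using neg sublinear_scale_nonneg[OF m, of "- r" x] by simp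
  qed
  with add show ?thesis unfolding linear_functional_iff by blast
qed

theorem hahn_banach_sublinear:
  assumes P: "sublinear P"
  obtains l where "Vector_Spaces.linear (*\<^sub>s) (*) l" "l \<le> P" "l z = P z"
proof -
  \<comment> \<open>Minimality below the reduct of \<open>P\<close> in direction \<open>z\<close>, not below \<open>P\<close>, is what
    forces \<open>m z \<ge> P z\<close>.\<close>
  obtain m where m: "sublinear m" "m \<le> directional_reduct P z"
    and minimal: "\<And>q. sublinear q \<Longrightarrow> q \<le> m \<Longrightarrow> q = m"
    using exists_minimal_sublinear_below[OF sublinear_directional_reduct[OF P]] by blast
  have linear: "Vector_Spaces.linear (*\<^sub>s) (*) m"
    by (rule minimal_sublinear_linear[OF m(1) minimal])
  have "m (- z) \<le> directional_reduct P z (- z)"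
    using m(2) by (simp add: le_fun_def)
  also have "\<dots> \<le> P (- z + 1 *\<^sub>s z) - 1 * P z"
    by (rule directional_reduct_le_shift[OF P]) simp
  also have "\<dots> = - P z"
    using sublinear_zero[OF P] by simp
  finally have "m (- z) \<le> - P z" .
  moreover have "m (- z) = - m z"
    using linear by (simp add: linear_iff_module_hom module_hom.neg)
  ultimately have "P z \<le> m z"
    by simp
  moreover have "m \<le> P"
    using m(2) directional_reduct_le[OF P] by (auto simp: le_fun_def intro: order.trans)
  ultimately show ?thesis
    using that[OF linear] by (simp add: le_fun_def order.antisym)
qed

definition minkowski_functional :: "'b set \<Rightarrow> 'b \<Rightarrow> real" where
  "minkowski_functional C x = Inf {t. t > 0 \<and> (1/t) *\<^sub>s x \<in> C}"

context
  fixes C :: "'b set"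
  assumes convex: "\<forall>x\<in>C. \<forall>y\<in>C. \<forall>t. 0 \<le> t \<and> t \<le> 1 \<longrightarrow> t *\<^sub>s x + (1 - t) *\<^sub>s y \<in> C"
    and absorbing: "\<forall>x. \<exists>r>0. r *\<^sub>s x \<in> C"
begin

private lemma minkowski_functional_le:
  "t > 0 \<Longrightarrow> (1/t) *\<^sub>s x \<in> C \<Longrightarrow> minkowski_functional C x \<le> t"
  unfolding minkowski_functional_def by (rule cInf_lower) (auto intro: bdd_belowI[of _ 0])

private lemma minkowski_functional_greatest:
  assumes "\<And>t. t > 0 \<Longrightarrow> (1/t) *\<^sub>s x \<in> C \<Longrightarrow> c \<le> t"
  shows "c \<le> minkowski_functional C x"
proof -
  obtain r where "r > 0" "r *\<^sub>s x \<in> C"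
    using absorbing by blast
  then have "1/r \<in> {t. t > 0 \<and> (1/t) *\<^sub>s x \<in> C}"
    by simp
  then have "{t. t > 0 \<and> (1/t) *\<^sub>s x \<in> C} \<noteq> {}"
    by blast
  then show ?thesis
    unfolding minkowski_functional_def by (rule cInf_greatest) (use assms in auto)
qed

lemma sublinear_minkowski_functional: "sublinear (minkowski_functional C)"
proof (rule sublinearI)
  fix x y
  have sum: "minkowski_functional C (x + y) \<le> s + t"
    if s: "s > 0" "(1/s) *\<^sub>s x \<in> C" and t: "t > 0" "(1/t) *\<^sub>s y \<in> C" for s t
  proof -
    have "(s/(s+t)) *\<^sub>s (1/s) *\<^sub>s x + (1 - s/(s+t)) *\<^sub>s (1/t) *\<^sub>s y \<in> C"
      using convex[rule_format, OF s(2) t(2), of "s/(s+t)"] s t by simp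
    also have "(s/(s+t)) *\<^sub>s (1/s) *\<^sub>s x + (1 - s/(s+t)) *\<^sub>s (1/t) *\<^sub>s y = (1/(s+t)) *\<^sub>s (x + y)"
    proof -
      have "1 - s/(s+t) = t/(s+t)" using s t by (simp add: field_simps)
      then show ?thesis using s t by (simp add: scale_right_distrib)
    qed
    finally show ?thesis using minkowski_functional_le[of "s+t" "x+y"] s t by simp
  qed
  have "minkowski_functional C (x + y) - t \<le> minkowski_functional C x"
    if "t > 0" "(1/t) *\<^sub>s y \<in> C" for t
    using sum[of _ t] that by (intro minkowski_functional_greatest) fastforce
  then have "minkowski_functional C (x + y) - minkowski_functional C x \<le> minkowski_functional C y"
    by (intro minkowski_functional_greatest) (simp add: algebra_simps)
  then show "minkowski_functional C (x + y) \<le> minkowski_functional C x + minkowski_functional C y"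
    by simp
next
  fix r :: real and x
  assume r: "r > 0"
  have "minkowski_functional C (r *\<^sub>s x) / r \<le> minkowski_functional C x"
  proof (rule minkowski_functional_greatest)
    fix t :: real
    assume t: "t > 0" "(1/t) *\<^sub>s x \<in> C"
    have "(1/(r*t)) *\<^sub>s r *\<^sub>s x = (1/t) *\<^sub>s x" using r by simp
    then have "minkowski_functional C (r *\<^sub>s x) \<le> r * t"
      using minkowski_functional_le[of "r*t" "r *\<^sub>s x"] r t by simp
    then show "minkowski_functional C (r *\<^sub>s x) / r \<le> t" using r by (simp add: field_simps)
  qed
  then show "minkowski_functional C (r *\<^sub>s x) \<le> r * minkowski_functional C x"
    using r by (simp add: field_simps)
qed

lemma minkowski_functional_le_one: "x \<in> C \<Longrightarrow> minkowski_functional C x \<le> 1"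
  using minkowski_functional_le[of 1 x] by simp

lemma one_le_minkowski_functional:
  assumes "x \<notin> C" shows "1 \<le> minkowski_functional C x"
proof (rule minkowski_functional_greatest, rule ccontr)
  fix t :: real
  assume t: "t > 0" "(1/t) *\<^sub>s x \<in> C" and "\<not> 1 \<le> t"
  have "0 \<in> C"
    using absorbing[rule_format, of 0] by auto
  with t \<open>\<not> 1 \<le> t\<close> have "t *\<^sub>s (1/t) *\<^sub>s x + (1 - t) *\<^sub>s 0 \<in> C"
    using convex[rule_format, of "(1/t) *\<^sub>s x" 0 t] by simp
  with t assms show False by simp
qed

end

end

lemma real_vector_space_of_real_scale:
  fixes scale :: "'a::real_field \<Rightarrow> 'b::ab_group_add \<Rightarrow> 'b"
  assumes "vector_space scale"
  shows "real_vector_space (\<lambda>r. scale (of_real r))"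
  using assms unfolding real_vector_space_def vector_space_def by simp

lemma hausdorff_lctvs_vector_space: "hausdorff_lctvs smul \<Longrightarrow> vector_space smul"
  unfolding hausdorff_lctvs_def complex_vs_def vector_space_def by (elim conjE) (intro conjI; assumption)

lemma continuous_on_lctvs_add:
  fixes smul :: "complex \<Rightarrow> 'x::{t2_space,ab_group_add} \<Rightarrow> 'x"
    and f g :: "'s::topological_space \<Rightarrow> 'x"
  assumes "hausdorff_lctvs smul" "continuous_on S f" "continuous_on S g"
  shows "continuous_on S (\<lambda>s. f s + g s)"
proof -
  have "continuous_on UNIV (\<lambda>p::'x \<times> 'x. fst p + snd p)"
    using assms(1) unfolding hausdorff_lctvs_def by blast
  from continuous_on_compose2[OF this continuous_on_Pair[OF assms(2,3)]] show ?thesis by simp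
qed

lemma continuous_on_lctvs_scale:
  assumes "hausdorff_lctvs smul" "continuous_on S f" "continuous_on S g"
  shows "continuous_on S (\<lambda>s. smul (f s) (g s))"
proof -
  have "continuous_on UNIV (\<lambda>p. smul (fst p) (snd p))"
    using assms(1) unfolding hausdorff_lctvs_def by blast
  from continuous_on_compose2[OF this continuous_on_Pair[OF assms(2,3)]] show ?thesis by simp
qed

lemma open_nhds_absorbing:
  fixes smul :: "complex \<Rightarrow> 'x::{t2_space,ab_group_add} \<Rightarrow> 'x"
  assumes X: "hausdorff_lctvs smul" and C: "open C" "0 \<in> C"
  shows "\<exists>r>0. smul (of_real r) x \<in> C"
proof -
  have "continuous_on UNIV (\<lambda>r::real. smul (of_real r) x)"
    by (rule continuous_on_lctvs_scale[OF X continuous_on_of_real[OF continuous_on_id] continuous_on_const])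
  then have "open ((\<lambda>r::real. smul (of_real r) x) -` C)"
    by (rule open_vimage[OF C(1)])
  moreover have "smul 0 x = 0"
    using hausdorff_lctvs_vector_space[OF X, folded module_iff_vector_space]
    by (rule module.scale_zero_left)
  then have "(0::real) \<in> (\<lambda>r::real. smul (of_real r) x) -` C"
    using C(2) by simp
  ultimately obtain d where d: "d > 0" "ball 0 d \<subseteq> (\<lambda>r::real. smul (of_real r) x) -` C"
    by (rule openE)
  then have "d/2 \<in> (\<lambda>r::real. smul (of_real r) x) -` C"
    by (intro subsetD[OF d(2)]) simp
  then have "smul (of_real (d/2)) x \<in> C"
    by blast
  moreover have "d/2 > 0"
    using d(1) by simp
  ultimately show ?thesis
    by blast
qed

lemma continuous_on_real_linear_functional:
  fixes smul :: "complex \<Rightarrow> 'x::{t2_space,ab_group_add} \<Rightarrow> 'x" and l :: "'x \<Rightarrow> real"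
  assumes X: "hausdorff_lctvs smul"
    and l: "Vector_Spaces.linear (\<lambda>r. smul (of_real r)) (*) l"
    and W: "open W" "0 \<in> W" "\<And>x. x \<in> W \<Longrightarrow> \<bar>l x\<bar> \<le> 1"
  shows "continuous_on UNIV l"
proof -
  interpret vector_space smul by (rule hausdorff_lctvs_vector_space[OF X])
  interpret l: Vector_Spaces.linear "\<lambda>r. smul (of_real r)" "(*)" l by (rule l)
  have "isCont l x0" for x0
    unfolding isCont_def tendsto_iff eventually_at_topological
  proof (intro allI impI)
    fix e :: real
    assume e: "e > 0"
    define g where "g y = smul (of_real (2/e)) (y + - x0)" for y
    have "continuous_on UNIV g"
      unfolding g_def
      by (intro continuous_on_lctvs_scale[OF X] continuous_on_lctvs_add[OF X]
          continuous_on_const continuous_on_id)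
    then have "open (g -` W)"
      by (rule open_vimage[OF W(1)])
    moreover have "x0 \<in> g -` W"
      using W(2) by (simp add: g_def)
    moreover have "dist (l y) (l x0) < e" if "y \<in> g -` W" for y
    proof -
      have "\<bar>l (g y)\<bar> \<le> 1"
        using that W(3) by simp
      moreover have "l (g y) = (2/e) * (l y - l x0)"
        unfolding g_def by (simp only: l.scale l.add l.neg) simp
      ultimately have "\<bar>2/e\<bar> * \<bar>l y - l x0\<bar> \<le> 1"
        by (metis abs_mult)
      then have "\<bar>l y - l x0\<bar> \<le> e/2"
        using e by (simp add: field_simps)
      then show ?thesis
        using e by (simp add: dist_real_def)
    qed
    ultimately show "\<exists>S. open S \<and> x0 \<in> S \<and> (\<forall>y\<in>S. y \<noteq> x0 \<longrightarrow> y \<in> UNIV \<longrightarrow> dist (l y) (l x0) < e)"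
      by blast
  qed
  then show ?thesis
    by (simp add: continuous_at_imp_continuous_on)
qed

lemma complexification_in_dual_space:
  fixes smul :: "complex \<Rightarrow> 'x::{t2_space,ab_group_add} \<Rightarrow> 'x" and l :: "'x \<Rightarrow> real"
  assumes X: "hausdorff_lctvs smul"
    and l: "Vector_Spaces.linear (\<lambda>r. smul (of_real r)) (*) l" and l_cont: "continuous_on UNIV l"
  shows "(\<lambda>x. of_real (l x) - \<i> * of_real (l (smul \<i> x))) \<in> dual_space smul"
proof -
  interpret vector_space smul by (rule hausdorff_lctvs_vector_space[OF X])
  interpret l: Vector_Spaces.linear "\<lambda>r. smul (of_real r)" "(*)" l by (rule l)
  define e where "e x = of_real (l x) - \<i> * of_real (l (smul \<i> x))" for x
  have l_smul: "l (smul c x) = Re c * l x + Im c * l (smul \<i> x)" for c x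
  proof -
    have "smul c x = smul (of_real (Re c)) x + smul (of_real (Im c)) (smul \<i> x)"
      by (metis complex_eq mult.commute scale_left_distrib scale_scale)
    then have "l (smul c x) = l (smul (of_real (Re c)) x) + l (smul (of_real (Im c)) (smul \<i> x))"
      by (simp only: l.add)
    then show ?thesis
      by (simp only: l.scale)
  qed
  have "e (x + y) = e x + e y" for x y
    unfolding e_def by (simp add: l.add algebra_simps)
  moreover have "e (smul c x) = c * e x" for c x
    unfolding e_def scale_scale using l_smul[of c x] l_smul[of "\<i> * c" x]
    by (simp add: complex_eq_iff)
  moreover have "continuous_on UNIV e"
  proof -
    have "continuous_on UNIV (\<lambda>x. l (smul \<i> x))"
      by (rule continuous_on_compose2[OF l_cont continuous_on_lctvs_scale[OF X]])
        (auto intro: continuous_on_const continuous_on_id)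
    then show ?thesis
      unfolding e_def by (intro continuous_intros l_cont)
  qed
  ultimately show ?thesis
    unfolding dual_space_def e_def by blast
qed

theorem dual_space_separates_points:
  fixes smul :: "complex \<Rightarrow> 'x::{t2_space,ab_group_add} \<Rightarrow> 'x"
  assumes X: "hausdorff_lctvs smul" and "p \<noteq> q"
  obtains e where "e \<in> dual_space smul" "Re (e p) < Re (e q)"
proof -
  interpret vector_space smul by (rule hausdorff_lctvs_vector_space[OF X])
  interpret R: real_vector_space "\<lambda>r. smul (of_real r)"
    by (rule real_vector_space_of_real_scale[OF vector_space_axioms])
  obtain U V where UV: "open U" "open V" "0 \<in> U" "q - p \<in> V" "U \<inter> V = {}"
    using hausdorff[of 0 "q - p"] \<open>p \<noteq> q\<close> by auto
  then obtain C where C: "open C" "0 \<in> C" "C \<subseteq> U" and "convex_wrt smul C"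
    using X unfolding hausdorff_lctvs_def by meson
  then have C_convex:
    "\<forall>x\<in>C. \<forall>y\<in>C. \<forall>t. 0 \<le> t \<and> t \<le> 1 \<longrightarrow> smul (of_real t) x + smul (of_real (1 - t)) y \<in> C"
    unfolding convex_wrt_def by blast
  have C_absorbing: "\<forall>x. \<exists>r>0. smul (of_real r) x \<in> C"
    using open_nhds_absorbing[OF X C(1,2)] by blast
  define \<mu> where "\<mu> = R.minkowski_functional C"
  note \<mu> = R.sublinear_minkowski_functional[OF C_convex C_absorbing, folded \<mu>_def]
    R.minkowski_functional_le_one[OF C_convex C_absorbing, folded \<mu>_def]
    R.one_le_minkowski_functional[OF C_convex C_absorbing, folded \<mu>_def]
  obtain l where l: "Vector_Spaces.linear (\<lambda>r. smul (of_real r)) (*) l" "l \<le> \<mu>" "l (q - p) = \<mu> (q - p)"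
    using R.hahn_banach_sublinear[OF \<mu>(1)] by blast
  interpret l: Vector_Spaces.linear "\<lambda>r. smul (of_real r)" "(*)" l by (rule l(1))
  have "q - p \<notin> C"
    using C(3) UV(4,5) by blast
  then have l_qp: "1 \<le> l (q - p)"
    using l(3) \<mu>(3) by simp
  have l_le_one: "l x \<le> 1" if "x \<in> C" for x
    using l(2) \<mu>(2)[OF that] unfolding le_fun_def by (meson order.trans)
  have "continuous_on UNIV (smul (- 1))"
    by (intro continuous_on_lctvs_scale[OF X] continuous_on_const continuous_on_id)
  then have "open (uminus -` C)"
    using open_vimage[OF C(1)] by simp
  have "continuous_on UNIV l"
  proof (rule continuous_on_real_linear_functional[OF X l(1), of "C \<inter> uminus -` C"])
    show "open (C \<inter> uminus -` C)" "0 \<in> C \<inter> uminus -` C"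
      using C(1,2) \<open>open (uminus -` C)\<close> by auto
    show "\<bar>l x\<bar> \<le> 1" if "x \<in> C \<inter> uminus -` C" for x
      using that l_le_one[of x] l_le_one[of "- x"] by (simp add: l.neg)
  qed
  define e where "e x = of_real (l x) - \<i> * of_real (l (smul \<i> x))" for x
  have "e \<in> dual_space smul"
    unfolding e_def by (rule complexification_in_dual_space[OF X l(1) \<open>continuous_on UNIV l\<close>])
  moreover have "Re (e p) < Re (e q)"
    using l_qp by (simp add: e_def l.diff)
  ultimately show ?thesis
    by (rule that)
qed

lemma z_filter_nonempty: "z_filter T \<F> \<Longrightarrow> \<F> \<noteq> {}"
  unfolding z_filter_def by (elim conjE)

lemma z_filter_Int_mem:
  assumes "z_filter T \<F>" "F \<in> \<F>" "G \<in> \<F>"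
  shows "F \<inter> G \<in> \<F>"
proof -
  have "\<forall>F\<in>\<F>. \<forall>G\<in>\<F>. F \<inter> G \<in> \<F>"
    using assms(1) unfolding z_filter_def by (elim conjE)
  with assms(2,3) show ?thesis
    by blast
qed

lemma z_filter_Inter_mem:
  assumes "z_filter T \<F>" and "finite \<G>" "\<G> \<noteq> {}" "\<G> \<subseteq> \<F>"
  shows "\<Inter>\<G> \<in> \<F>"
  using assms(2-4)
proof (induction \<G> rule: finite_ne_induct)
  case (insert F \<G>)
  then show ?case
    using z_filter_Int_mem[OF assms(1)] by simp
qed simp

lemma z_filter_Inter_closure_image_nonempty:
  assumes \<F>: "z_filter T \<F>" and meets: "\<And>F. F \<in> \<F> \<Longrightarrow> F \<inter> S \<noteq> {}"
    and compact: "compact (closure (h ` S))"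
  shows "(\<Inter>F\<in>\<F>. closure (h ` (F \<inter> S))) \<noteq> {}"
proof -
  have "closure (h ` S) \<inter> (\<Inter>F\<in>\<F>. closure (h ` (F \<inter> S))) \<noteq> {}"
  proof (rule compact_imp_fip_image[OF compact])
    fix \<G> assume \<G>: "finite \<G>" "\<G> \<subseteq> \<F>"
    have "\<exists>x\<in>S. \<forall>F\<in>\<G>. x \<in> F"
    proof (cases "\<G> = {}")
      case True
      obtain F where "F \<in> \<F>"
        using z_filter_nonempty[OF \<F>] by blast
      with meets True show ?thesis by blast
    next
      case False
      then have "\<Inter>\<G> \<in> \<F>"
        by (rule z_filter_Inter_mem[OF \<F> \<G>(1) _ \<G>(2)])
      with meets show ?thesis by blast
    qed
    then obtain x where "x \<in> S" "\<And>F. F \<in> \<G> \<Longrightarrow> x \<in> F"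
      by blast
    then have "h x \<in> closure (h ` S) \<inter> (\<Inter>F\<in>\<G>. closure (h ` (F \<inter> S)))"
      using closure_subset by fastforce
    then show "closure (h ` S) \<inter> (\<Inter>F\<in>\<G>. closure (h ` (F \<inter> S))) \<noteq> {}"
      by blast
  qed simp
  then show ?thesis
    by blast
qed

lemma antisymmetric_zfD:
  assumes "antisymmetric_zf T A v \<F>"
  shows "z_filter T \<F>" and "\<And>F. F \<in> \<F> \<Longrightarrow> F \<inter> supp T v \<noteq> {}"
proof -
  show "z_filter T \<F>"
    using assms unfolding antisymmetric_zf_def by (elim conjE)
  have "\<forall>F\<in>\<F>. F \<inter> supp T v \<noteq> {}"
    using assms unfolding antisymmetric_zf_def by (elim conjE)
  then show "\<And>F. F \<in> \<F> \<Longrightarrow> F \<inter> supp T v \<noteq> {}"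
    by blast
qed

lemma beta_separates_Inter_closure_subsingleton:
  fixes smul :: "complex \<Rightarrow> 'x::{t2_space,ab_group_add} \<Rightarrow> 'x" and h :: "'a \<Rightarrow> 'x"
  assumes X: "hausdorff_lctvs smul" and sep: "beta_separates T A v smul h"
    and \<F>: "antisymmetric_zf T A v \<F>"
    and p: "p \<in> (\<Inter>F\<in>\<F>. closure (h ` (F \<inter> supp T v)))"
    and q: "q \<in> (\<Inter>F\<in>\<F>. closure (h ` (F \<inter> supp T v)))"
  shows "p = q"
proof (rule ccontr)
  assume "p \<noteq> q"
  then obtain e where e: "e \<in> dual_space smul" "Re (e p) < Re (e q)"
    by (rule dual_space_separates_points[OF X])
  define a b where "a = (2 * Re (e p) + Re (e q)) / 3" and "b = (Re (e p) + 2 * Re (e q)) / 3"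
  have "a < b" "Re (e p) < a" "b < Re (e q)"
    using e(2) by (simp_all add: a_def b_def)
  obtain F where F: "F \<in> \<F>"
    and "F \<inter> {x \<in> supp T v. Re (e (h x)) \<le> a} = {} \<or> F \<inter> {x \<in> supp T v. Re (e (h x)) \<ge> b} = {}"
    using sep[unfolded beta_separates_def, rule_format, OF conjI[OF \<F> conjI[OF e(1) \<open>a < b\<close>]]]
    by blast
  moreover have "continuous_on UNIV (\<lambda>y. Re (e y))"
    using e(1) unfolding dual_space_def by (auto intro: continuous_on_Re)
  then have "closed {y. a \<le> Re (e y)}" "closed {y. Re (e y) \<le> b}"
    by (auto intro: closed_Collect_le continuous_on_const)
  ultimately show False
  proof (elim disjE)
    assume "F \<inter> {x \<in> supp T v. Re (e (h x)) \<le> a} = {}"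
    then have "h ` (F \<inter> supp T v) \<subseteq> {y. a \<le> Re (e y)}"
      by force
    then have "closure (h ` (F \<inter> supp T v)) \<subseteq> {y. a \<le> Re (e y)}"
      using \<open>closed {y. a \<le> Re (e y)}\<close> by (rule closure_minimal)
    then show False
      using p F \<open>Re (e p) < a\<close> by force
  next
    assume "F \<inter> {x \<in> supp T v. Re (e (h x)) \<ge> b} = {}"
    then have "h ` (F \<inter> supp T v) \<subseteq> {y. Re (e y) \<le> b}"
      by force
    then have "closure (h ` (F \<inter> supp T v)) \<subseteq> {y. Re (e y) \<le> b}"
      using \<open>closed {y. Re (e y) \<le> b}\<close> by (rule closure_minimal)
    then show False
      using q F \<open>b < Re (e q)\<close> by force
  qed
qed

lemma antisymmetric_zf_Inter_closure_singleton:
  fixes smul :: "complex \<Rightarrow> 'x::{t2_space,ab_group_add} \<Rightarrow> 'x" and h :: "'a \<Rightarrow> 'x"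
  assumes X: "hausdorff_lctvs smul" and compact: "compact (closure (h ` supp T v))"
    and sep: "beta_separates T A v smul h" and \<F>: "antisymmetric_zf T A v \<F>"
  shows "\<exists>p. (\<Inter>F\<in>\<F>. closure (h ` (F \<inter> supp T v))) = {p}"
proof -
  obtain p where "p \<in> (\<Inter>F\<in>\<F>. closure (h ` (F \<inter> supp T v)))"
    using z_filter_Inter_closure_image_nonempty[OF antisymmetric_zfD[OF \<F>] compact] by blast
  with beta_separates_Inter_closure_subsingleton[OF X sep \<F>] show ?thesis
    by blast
qed

theorem lemma3p5:
  fixes T :: "'a topology" and smul :: "complex \<Rightarrow> 'x::{t2_space,ab_group_add} \<Rightarrow> 'x"
    and A :: "('a \<Rightarrow> complex) set" and f :: "'a \<Rightarrow> 'x" and v :: "'a \<Rightarrow> real"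
  assumes X: "hausdorff_lctvs smul"
    and A: "\<forall>\<phi>\<in>A. continuous_map T euclidean \<phi>"
    and v: "\<forall>x\<in>topspace T. v x \<ge> 0"
  shows
    "(compact (closure ((\<lambda>x. smul (complex_of_real (v x)) (f x)) ` topspace T)) \<and>
      continuous_map (subtopology T (supp T v)) euclidean (\<lambda>x. smul (complex_of_real (v x)) (f x)) \<and>
      beta_separates T A v smul (\<lambda>x. smul (complex_of_real (v x)) (f x))
      \<longrightarrow> (\<forall>\<F>. antisymmetric_zf T A v \<F> \<longrightarrow>
            (\<exists>p. (\<Inter>F\<in>\<F>. closure ((\<lambda>x. smul (complex_of_real (v x)) (f x)) ` (F \<inter> supp T v))) = {p})))
   \<and>
     (compact (closure (f ` supp T v)) \<and>
      continuous_map (subtopology T (supp T v)) euclidean f \<and>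
      beta_separates T A v smul f
      \<longrightarrow> (\<forall>\<F>. antisymmetric_zf T A v \<F> \<longrightarrow>
            (\<exists>p. (\<Inter>F\<in>\<F>. closure (f ` (F \<inter> supp T v))) = {p})))"
proof (intro conjI impI allI; elim conjE)
  fix \<F>
  let ?vf = "\<lambda>x. smul (complex_of_real (v x)) (f x)"
  assume compact: "compact (closure (?vf ` topspace T))"
    and sep: "beta_separates T A v smul ?vf" and \<F>: "antisymmetric_zf T A v \<F>"
  have "compact (closure (?vf ` topspace T) \<inter> closure (?vf ` supp T v))"
    by (rule compact_Int_closed[OF compact closed_closure])
  moreover have "closure (?vf ` supp T v) \<subseteq> closure (?vf ` topspace T)"
    unfolding supp_def by (intro closure_mono image_mono closure_of_subset_topspace)
  ultimately have "compact (closure (?vf ` supp T v))"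
    by (simp add: Int_absorb1)
  then show "\<exists>p. (\<Inter>F\<in>\<F>. closure (?vf ` (F \<inter> supp T v))) = {p}"
    by (rule antisymmetric_zf_Inter_closure_singleton[OF X _ sep \<F>])
next
  fix \<F>
  assume "compact (closure (f ` supp T v))" "beta_separates T A v smul f" "antisymmetric_zf T A v \<F>"
  then show "\<exists>p. (\<Inter>F\<in>\<F>. closure (f ` (F \<inter> supp T v))) = {p}"
    by (rule antisymmetric_zf_Inter_closure_singleton[OF X])
qed

end
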